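(* Let $\mathcal{H}$ be a complex separable Hilbert space, $W$ a bounded positive semi-definite operator on $\mathcal{H}$, $A\subseteq\mathcal{H}\times\mathcal{H}$ a linear relation, and $b\in\mathcal{H}$. There exists a $W$-least squares solution of the inclusion $b\in Ax$ if and only if $b\in\operatorname{dom}P_{W,\operatorname{ran}A}$. Therefore, there exists a $W$-least squares solution of $b\in Ax$ for every $b\in\mathcal{H}$ if and only if $W$ is $\operatorname{ran}A$-complementable.
   Context: A linear relation in $\mathcal{H}$ is a linear subspace $A$ of $\mathcal{H}\times\mathcal{H}$; $\operatorname{dom}A$, $\operatorname{ran}A$ are its domain and range, and $Ax=\{y:(x,y)\in A\}$. $\|x\|_W:=\|W^{1/2}x\|$. A vector $x_0\in\mathcal{H}$ is a $W$-least squares solution of the inclusion $b\in Ax$ if $x_0\in\operatorname{dom}A$ and there exists $z\in Ax_0$ such that $\|z-b\|_W=\min_{y\in\operatorname{ran}A}\|y-b\|_W$. For a (not necessarily closed) subspace $\mathcal{S}$ of $\mathcal{H}$, $P_{W,\mathcal{S}}:=\{(s+n,s):s\in\mathcal{S},\ n\in(W\mathcal{S})^\perp\}$, where $(W\mathcal{S})^\perp=\{x:\langle Wx,s\rangle=0\ \forall s\in\mathcal{S}\}$; so $\operatorname{dom}P_{W,\mathcal{S}}=\mathcal{S}+(W\mathcal{S})^\perp$. $W$ is $\mathcal{S}$-complementable if $\operatorname{dom}P_{W,\mathcal{S}}=\mathcal{H}$. *)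

theory Defs
  imports "HOL-Analysis.Analysis" "HOL-Library.Complex_Order"
begin

section \<open>Complex Hilbert spaces\<close>

class complex_vector = real_vector +
  fixes scaleC :: "complex \<Rightarrow> 'a \<Rightarrow> 'a" (infixr \<open>*\<^sub>C\<close> 75)
  assumes scaleC_add_right: "c *\<^sub>C (x + y) = c *\<^sub>C x + c *\<^sub>C y"
    and scaleC_add_left: "(c + d) *\<^sub>C x = c *\<^sub>C x + d *\<^sub>C x"
    and scaleC_scaleC: "c *\<^sub>C (d *\<^sub>C x) = (c * d) *\<^sub>C x"
    and scaleC_one: "1 *\<^sub>C x = x"
    and scaleR_scaleC: "r *\<^sub>R x = complex_of_real r *\<^sub>C x"

global_interpretation complex_vector: vector_space "scaleC :: complex \<Rightarrow> 'a \<Rightarrow> 'a::complex_vector"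
  by unfold_locales
    (simp_all add: scaleC_add_right scaleC_add_left scaleC_scaleC scaleC_one)

instantiation prod :: (complex_vector, complex_vector) complex_vector
begin

definition scaleC_prod :: "complex \<Rightarrow> 'a \<times> 'b \<Rightarrow> 'a \<times> 'b"
  where "scaleC_prod c p = (c *\<^sub>C fst p, c *\<^sub>C snd p)"

instance
  by standard
    (simp_all add: scaleC_prod_def scaleC_add_right scaleC_add_left scaleC_scaleC scaleC_one
      scaleR_prod_def scaleR_scaleC)

end

text \<open>The form is linear in its first argument. The last axiom makes the norm of the type
  the one induced by the form; with the Hermitian symmetry, positive definiteness of the form
  is then that of the real inner product.\<close>

class complex_inner = complex_vector + real_inner +
  fixes cinner :: "'a \<Rightarrow> 'a \<Rightarrow> complex"
  assumes cinner_commute: "cinner x y = cnj (cinner y x)"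
    and cinner_add_left: "cinner (x + y) z = cinner x z + cinner y z"
    and cinner_scaleC_left: "cinner (c *\<^sub>C x) y = c * cinner x y"
    and inner_eq_Re_cinner: "inner x y = Re (cinner x y)"
begin

lemma norm_eq_sqrt_cinner: "norm x = sqrt (Re (cinner x x))"
  by (simp add: norm_eq_sqrt_inner inner_eq_Re_cinner)

lemma cinner_ge_zero: "0 \<le> cinner x x"
proof -
  have "Im (cinner x x) = 0"
    using arg_cong[OF cinner_commute[of x x], of Im] by simp
  moreover have "0 \<le> Re (cinner x x)"
    using inner_ge_zero[of x] by (simp add: inner_eq_Re_cinner)
  ultimately show ?thesis
    by (simp add: less_eq_complex_def)
qed

lemma cinner_eq_zero_iff: "cinner x x = 0 \<longleftrightarrow> x = 0"
proof
  assume "cinner x x = 0"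
  then have "inner x x = 0" by (simp add: inner_eq_Re_cinner)
  then show "x = 0" by simp
next
  assume "x = 0"
  have "cinner (0 + 0) 0 = cinner 0 0 + cinner 0 0" by (rule cinner_add_left)
  with \<open>x = 0\<close> show "cinner x x = 0" by simp
qed

end

class chilbert_space = complex_inner + complete_space

section \<open>Operators\<close>

definition bounded_clinear :: "('a::chilbert_space \<Rightarrow> 'a) \<Rightarrow> bool"
  where "bounded_clinear T \<longleftrightarrow> bounded_linear T \<and> (\<forall>c x. T (c *\<^sub>C x) = c *\<^sub>C T x)"

text \<open>The order on \<^typ>\<open>complex\<close> makes \<^term>\<open>0 \<le> z\<close> mean that \<^term>\<open>z\<close> is real and
  nonnegative; on a complex space this already forces the operator to be self-adjoint.\<close>

definition pos_semidef :: "('a::chilbert_space \<Rightarrow> 'a) \<Rightarrow> bool"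
  where "pos_semidef T \<longleftrightarrow> bounded_clinear T \<and> (\<forall>x. 0 \<le> cinner (T x) x)"

text \<open>For positive semidefinite \<open>W\<close> on a Hilbert space exactly one such \<open>R\<close> exists; for other \<open>W\<close>
  the value is meaningless.\<close>

definition op_sqrt :: "('a::chilbert_space \<Rightarrow> 'a) \<Rightarrow> 'a \<Rightarrow> 'a"
  where "op_sqrt W = (THE R. pos_semidef R \<and> R \<circ> R = W)"

definition seminorm_W :: "('a::chilbert_space \<Rightarrow> 'a) \<Rightarrow> 'a \<Rightarrow> real"
  where "seminorm_W W x = norm (op_sqrt W x)"

section \<open>Linear relations and weighted least squares\<close>

definition linear_relation :: "('a::chilbert_space \<times> 'a) set \<Rightarrow> bool"
  where "linear_relation A \<longleftrightarrow> complex_vector.subspace A"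

definition wls_solution ::
    "('a::chilbert_space \<Rightarrow> 'a) \<Rightarrow> ('a \<times> 'a) set \<Rightarrow> 'a \<Rightarrow> 'a \<Rightarrow> bool"
  where "wls_solution W A b x\<^sub>0 \<longleftrightarrow> x\<^sub>0 \<in> Domain A \<and>
    (\<exists>z \<in> A `` {x\<^sub>0}. is_arg_min (\<lambda>y. seminorm_W W (y - b)) (\<lambda>y. y \<in> Range A) z)"

definition W_orth :: "('a::chilbert_space \<Rightarrow> 'a) \<Rightarrow> 'a set \<Rightarrow> 'a set"
  where "W_orth W S = {x. \<forall>s\<in>S. cinner (W x) s = 0}"

definition W_proj :: "('a::chilbert_space \<Rightarrow> 'a) \<Rightarrow> 'a set \<Rightarrow> ('a \<times> 'a) set"
  where "W_proj W S = {(s + n, s) | s n. s \<in> S \<and> n \<in> W_orth W S}"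

definition W_complementable :: "('a::chilbert_space \<Rightarrow> 'a) \<Rightarrow> 'a set \<Rightarrow> bool"
  where "W_complementable W S \<longleftrightarrow> Domain (W_proj W S) = UNIV"

end

theory Submission
  imports Defs
begin

text \<open>If \<open>R\<close> is the positive square root of \<open>W\<close>, then \<open>\<parallel>x\<parallel>\<^sub>W\<^sup>2 = \<langle>W x, x\<rangle>\<close>, and
  minimising this quadratic form over the affine space \<open>ran A - b\<close> is equivalent to \<open>W\<close>-orthogonality
  of the residual \<open>z - b\<close> to \<open>ran A\<close>.  That \<open>R\<close> exists is shown for \<open>\<parallel>W\<parallel> \<le> 1\<close> by iterating
  \<open>X \<mapsto> (B + X\<^sup>2)/2\<close> with \<open>B = I - W\<close>: as \<open>\<parallel>B\<parallel> \<le> 1\<close>, the increments are dominated by those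
  of the scalar iteration \<open>x \<mapsto> (1 + x\<^sup>2)/2\<close>, so the iterates converge in norm, and \<open>R = I - X\<close>.
  This \<open>R\<close> commutes with everything that commutes with \<open>W\<close>, which yields uniqueness.\<close>

instance chilbert_space \<subseteq> banach ..

section \<open>Positive semidefinite operators\<close>

lemma cinner_add_right: "cinner x (y + z) = cinner x y + cinner x (z::'a::complex_inner)"
  by (metis cinner_add_left cinner_commute complex_cnj_add)

lemma cinner_scaleC_right: "cinner x (c *\<^sub>C y) = cnj c * cinner x (y::'a::complex_inner)"
  by (metis cinner_scaleC_left cinner_commute complex_cnj_mult)

lemma Im_cinner: "Im (cinner x y) = inner x (\<i> *\<^sub>C (y::'a::complex_inner))"
  by (simp add: inner_eq_Re_cinner cinner_scaleC_right)

lemma inner_scaleC_i: "inner (\<i> *\<^sub>C x) y = - inner x (\<i> *\<^sub>C (y::'a::complex_inner))"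
  by (simp add: inner_eq_Re_cinner cinner_scaleC_left cinner_scaleC_right)

lemma bounded_clinear_scaleC: "bounded_clinear T \<Longrightarrow> T (c *\<^sub>C x) = c *\<^sub>C T x"
  by (simp add: bounded_clinear_def)

lemma pos_semidef_bounded_linear: "pos_semidef T \<Longrightarrow> bounded_linear T"
  by (simp add: pos_semidef_def bounded_clinear_def)

lemma pos_semidef_nonneg: "pos_semidef T \<Longrightarrow> 0 \<le> inner (T x) x"
  by (simp add: pos_semidef_def inner_eq_Re_cinner less_eq_complex_def)

text \<open>Polarisation: the form is real at \<open>x + i y\<close>, and the imaginary part of its
  cross terms is the difference of the two sides.\<close>

lemma pos_semidef_symmetric:
  assumes "pos_semidef T"
  shows "inner (T x) y = inner x (T y)"
proof -
  interpret T: bounded_linear T by (rule pos_semidef_bounded_linear[OF assms])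
  have T: "T (c *\<^sub>C x) = c *\<^sub>C T x" for c x
    using assms by (simp add: pos_semidef_def bounded_clinear_def)
  have im: "Im (cinner (T u) u) = 0" for u
    using assms by (simp add: pos_semidef_def less_eq_complex_def)
  have "Im (cinner (T (x + \<i> *\<^sub>C y)) (x + \<i> *\<^sub>C y)) = 0" by (rule im)
  then have "Re (cinner (T x) y) = Re (cinner (T y) x)"
    using im[of x] im[of y]
    by (simp add: T.add T cinner_add_left cinner_add_right cinner_scaleC_left cinner_scaleC_right)
  then show ?thesis by (simp add: inner_eq_Re_cinner[symmetric] inner_commute)
qed

text \<open>Multiplication by \<open>i\<close> commutes with \<open>T\<close> and is skew for the
  real inner product, so the imaginary part of the form equals its own negative. Real symmetry and
  nonnegativity thus suffice.\<close>

lemma pos_semidefI: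
  assumes T: "bounded_clinear T"
    and sym: "\<And>x y. inner (T x) y = inner x (T y)"
    and nonneg: "\<And>x. 0 \<le> inner (T x) x"
  shows "pos_semidef T"
proof -
  have "Im (cinner (T x) x) = 0" for x
  proof -
    have "inner (T x) (\<i> *\<^sub>C x) = inner x (\<i> *\<^sub>C T x)"
      by (simp add: sym bounded_clinear_scaleC[OF T])
    also have "\<dots> = - inner (T x) (\<i> *\<^sub>C x)"
      using inner_scaleC_i[of x "T x"] inner_scaleC_i[of "T x" x] by (simp add: inner_commute)
    finally show ?thesis by (simp add: Im_cinner)
  qed
  with T nonneg show ?thesis
    by (simp add: pos_semidef_def less_eq_complex_def inner_eq_Re_cinner)
qed

lemma quadratic_nonneg_imp_discriminant:
  fixes a b c :: real
  assumes nonneg: "\<And>t. 0 \<le> a + 2 * t * b + t\<^sup>2 * c" and "0 \<le> c"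
  shows "b\<^sup>2 \<le> a * c"
proof (cases "c = 0")
  case True
  have "b = 0"
  proof (rule ccontr)
    assume "b \<noteq> 0"
    \<comment> \<open>Without a quadratic term the polynomial is affine in \<open>t\<close>; this
      \<open>t\<close> is where it takes the value -1.\<close>
    then have "a + 2 * (- (a + 1) / (2 * b)) * b + (- (a + 1) / (2 * b))\<^sup>2 * c = - 1"
      using True by (simp add: field_simps)
    with nonneg[of "- (a + 1) / (2 * b)"] show False by linarith
  qed
  with True show ?thesis by simp
next
  case False
  with \<open>0 \<le> c\<close> have "0 < c" by simp
  \<comment> \<open>The minimiser of the quadratic.\<close>
  have "a + 2 * (- b / c) * b + (- b / c)\<^sup>2 * c = (a * c - b\<^sup>2) / c"
    using \<open>0 < c\<close> by (simp add: field_simps power2_eq_square)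
  with nonneg[of "- b / c"] \<open>0 < c\<close> show ?thesis by (simp add: zero_le_divide_iff)
qed

lemma pos_semidef_inner_add_scaleR:
  assumes "pos_semidef T"
  shows "inner (T (x + t *\<^sub>R y)) (x + t *\<^sub>R y)
    = inner (T x) x + 2 * t * inner (T x) y + t\<^sup>2 * inner (T y) y"
proof -
  interpret T: bounded_linear T by (rule pos_semidef_bounded_linear[OF assms])
  have "inner (T y) x = inner (T x) y"
    using pos_semidef_symmetric[OF assms, of y x] by (simp only: inner_commute)
  then show ?thesis
    by (simp add: T.add T.scale inner_add_left inner_add_right power2_eq_square algebra_simps)
qed

text \<open>The form at \<open>x + t y\<close> is a nonnegative quadratic in \<open>t\<close>, and
  this is its discriminant inequality.\<close>

lemma pos_semidef_Cauchy_Schwarz: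
  assumes "pos_semidef T"
  shows "(inner (T x) y)\<^sup>2 \<le> inner (T x) x * inner (T y) y"
  by (rule quadratic_nonneg_imp_discriminant)
    (simp_all add: pos_semidef_inner_add_scaleR[OF assms, symmetric] pos_semidef_nonneg[OF assms])

lemma pos_semidef_eq_zero:
  assumes "pos_semidef T" "inner (T x) x = 0"
  shows "T x = 0"
  using pos_semidef_Cauchy_Schwarz[OF assms(1), of x "T x"] assms(2) by simp

lemma pos_semidef_scaleR:
  assumes T: "pos_semidef T" and "0 \<le> r"
  shows "pos_semidef (\<lambda>x. r *\<^sub>R T x)"
proof (rule pos_semidefI)
  have "bounded_linear (\<lambda>x. r *\<^sub>R T x)"
    by (rule bounded_linear_const_scaleR[OF pos_semidef_bounded_linear[OF T]])
  moreover have "T (c *\<^sub>C x) = c *\<^sub>C T x" for c x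
    using T by (simp add: pos_semidef_def bounded_clinear_def)
  ultimately show "bounded_clinear (\<lambda>x. r *\<^sub>R T x)"
    by (simp add: bounded_clinear_def scaleR_scaleC scaleC_scaleC mult.commute)
  show "inner (r *\<^sub>R T x) y = inner x (r *\<^sub>R T y)" for x y
    by (simp add: pos_semidef_symmetric[OF T])
  show "0 \<le> inner (r *\<^sub>R T x) x" for x
    using \<open>0 \<le> r\<close> pos_semidef_nonneg[OF T] by simp
qed

text \<open>Cauchy-Schwarz at \<open>x\<close> and \<open>W x\<close> bounds the square of
  \<open>norm (W x)\<close> by \<open>inner (W x) x\<close>, which the cross term in the square of
  \<open>norm (x - W x)\<close> outweighs. This supplies the bound on \<open>B\<close> needed by the
  iteration.\<close>

lemma pos_semidef_diff_norm_le:
  assumes W: "pos_semidef W" and contr: "\<And>x. norm (W x) \<le> norm x"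
  shows "norm (x - W x) \<le> norm x"
proof -
  have "inner (W (W x)) (W x) \<le> norm (W (W x)) * norm (W x)"
    by (rule norm_cauchy_schwarz)
  also have "\<dots> \<le> (norm (W x))\<^sup>2"
    using contr[of "W x"] by (simp add: power2_eq_square mult_right_mono)
  finally have "inner (W x) x * inner (W (W x)) (W x) \<le> inner (W x) x * (norm (W x))\<^sup>2"
    by (simp add: mult_left_mono pos_semidef_nonneg[OF W])
  with pos_semidef_Cauchy_Schwarz[OF W, of x "W x"]
  have "(norm (W x))\<^sup>2 * (norm (W x))\<^sup>2 \<le> inner (W x) x * (norm (W x))\<^sup>2"
    unfolding power2_norm_eq_inner by (simp add: power2_eq_square)
  then have "(norm (W x))\<^sup>2 \<le> inner (W x) x"
    using pos_semidef_nonneg[OF W, of x] unfolding mult_le_cancel_right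
    by (cases "W x = 0") auto
  then have "(norm (x - W x))\<^sup>2 \<le> (norm x)\<^sup>2"
    using pos_semidef_nonneg[OF W, of x]
    by (simp add: power2_norm_eq_inner inner_diff_left inner_diff_right inner_commute)
  then show ?thesis by (rule power2_le_imp_le) simp
qed

section \<open>The positive square root\<close>

text \<open>Solving (I - X)^2 = I - B for the linear occurrence of X gives the fixed point equation
  that is iterated here.\<close>

primrec sqrt_iter :: "('a::real_normed_vector \<Rightarrow>\<^sub>L 'a) \<Rightarrow> nat \<Rightarrow> ('a \<Rightarrow>\<^sub>L 'a)"
  where "sqrt_iter B 0 = 0"
  | "sqrt_iter B (Suc n) = (1/2) *\<^sub>R (B + (sqrt_iter B n o\<^sub>L sqrt_iter B n))"

primrec sqrt_maj :: "nat \<Rightarrow> real"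
  where "sqrt_maj 0 = 0"
  | "sqrt_maj (Suc n) = (1 + (sqrt_maj n)\<^sup>2) / 2"

lemma sqrt_maj_bounds: "0 \<le> sqrt_maj n" "sqrt_maj n \<le> 1"
proof (induction n)
  case (Suc n)
  { case 2 show ?case using power_le_one[OF Suc] by simp }
qed simp_all

text \<open>The increment is half the square of \<open>sqrt_maj n - 1\<close>.\<close>

lemma sqrt_maj_mono: "sqrt_maj n \<le> sqrt_maj (Suc n)"
  using zero_le_power2[of "sqrt_maj n - 1"] by (simp add: power2_diff)

lemma norm_sqrt_iter:
  assumes "norm B \<le> 1"
  shows "norm (sqrt_iter B n) \<le> sqrt_maj n"
proof (induction n)
  case (Suc n)
  have "norm (sqrt_iter B n o\<^sub>L sqrt_iter B n) \<le> norm (sqrt_iter B n) * norm (sqrt_iter B n)"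
    by (rule norm_blinfun_compose)
  also have "\<dots> \<le> (sqrt_maj n)\<^sup>2"
    unfolding power2_eq_square using Suc by (intro mult_mono) (simp_all add: sqrt_maj_bounds)
  finally have "norm (B + (sqrt_iter B n o\<^sub>L sqrt_iter B n)) \<le> 1 + (sqrt_maj n)\<^sup>2"
    using assms norm_triangle_ineq[of B "sqrt_iter B n o\<^sub>L sqrt_iter B n"] by linarith
  then show ?case by simp
qed simp

lemma norm_sqrt_iter_diff:
  assumes B: "norm B \<le> 1"
  shows "norm (sqrt_iter B (Suc n) - sqrt_iter B n) \<le> sqrt_maj (Suc n) - sqrt_maj n"
proof (induction n)
  case 0
  then show ?case using B by simp
next
  case (Suc n)
  let ?X = "sqrt_iter B (Suc n)" and ?Y = "sqrt_iter B n"
  let ?x = "sqrt_maj (Suc n)" and ?y = "sqrt_maj n"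
  have nX: "norm ?X \<le> ?x" and nY: "norm ?Y \<le> ?y"
    by (rule norm_sqrt_iter[OF B])+
  have "norm (?X o\<^sub>L (?X - ?Y)) \<le> norm ?X * norm (?X - ?Y)"
    by (rule norm_blinfun_compose)
  also have "\<dots> \<le> ?x * (?x - ?y)"
    by (intro mult_mono nX Suc sqrt_maj_bounds norm_ge_zero)
  finally have 1: "norm (?X o\<^sub>L (?X - ?Y)) \<le> ?x * (?x - ?y)" .
  have "norm ((?X - ?Y) o\<^sub>L ?Y) \<le> norm (?X - ?Y) * norm ?Y"
    by (rule norm_blinfun_compose)
  also have "\<dots> \<le> (?x - ?y) * ?y"
    using sqrt_maj_mono[of n] by (intro mult_mono nY Suc norm_ge_zero) simp
  finally have 2: "norm ((?X - ?Y) o\<^sub>L ?Y) \<le> (?x - ?y) * ?y" .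
  have "sqrt_iter B (Suc (Suc n)) - ?X
      = (1/2) *\<^sub>R (B + (?X o\<^sub>L ?X)) - (1/2) *\<^sub>R (B + (?Y o\<^sub>L ?Y))"
    by (simp only: sqrt_iter.simps)
  \<comment> \<open>This splitting of the difference of squares needs no commutation of the
    iterates, and its scalar counterpart is exact for the majorant.\<close>
  also have "\<dots> = (1/2) *\<^sub>R ((?X o\<^sub>L (?X - ?Y)) + ((?X - ?Y) o\<^sub>L ?Y))"
    by (rule blinfun_eqI) (simp add: blinfun.bilinear_simps algebra_simps del: sqrt_iter.simps)
  also have "norm \<dots> \<le> (?x * (?x - ?y) + (?x - ?y) * ?y) / 2"
    using norm_triangle_ineq[of "?X o\<^sub>L (?X - ?Y)" "(?X - ?Y) o\<^sub>L ?Y"] 1 2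
    by (simp del: sqrt_iter.simps sqrt_maj.simps)
  also have "\<dots> = (1 + ?x\<^sup>2) / 2 - (1 + ?y\<^sup>2) / 2"
    by (simp add: power2_eq_square algebra_simps diff_divide_distrib add_divide_distrib
        del: sqrt_maj.simps)
  finally show ?case by (simp only: sqrt_maj.simps)
qed

text \<open>The majorant is monotone and bounded, so its increments are summable; by comparison so
  are those of the iterates, in the Banach space of bounded operators.\<close>

lemma convergent_sqrt_iter:
  fixes B :: "'a::banach \<Rightarrow>\<^sub>L 'a"
  assumes B: "norm B \<le> 1"
  shows "convergent (sqrt_iter B)"
proof -
  have "convergent sqrt_maj"
    by (rule Bseq_mono_convergent)
      (auto intro!: BseqI'[of _ 1] lift_Suc_mono_le[of sqrt_maj] sqrt_maj_mono
        simp: sqrt_maj_bounds simp del: sqrt_maj.simps)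
  then obtain l where "sqrt_maj \<longlonglongrightarrow> l" by (auto simp: convergent_def)
  then have "summable (\<lambda>n. sqrt_maj (Suc n) - sqrt_maj n)" by (rule telescope_summable)
  then have "summable (\<lambda>n. sqrt_iter B (Suc n) - sqrt_iter B n)"
    by (rule summable_comparison_test'[of _ 0]) (rule norm_sqrt_iter_diff[OF B])
  \<comment> \<open>The telescoped sums are the iterates themselves because the iteration starts at
    0.\<close>
  moreover have "(\<lambda>n. \<Sum>k<n. sqrt_iter B (Suc k) - sqrt_iter B k) = sqrt_iter B"
    by (simp add: sum_lessThan_telescope del: sqrt_iter.simps(2))
  ultimately show ?thesis by (metis convergent_def summable_LIMSEQ)
qed

section \<open>Properties that the iterates inherit from \<open>B\<close>\<close>

lemma sqrt_iter_commute:
  assumes S: "bounded_linear S" and comm: "\<And>x. S (blinfun_apply B x) = blinfun_apply B (S x)"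
  shows "S (blinfun_apply (sqrt_iter B n) x) = blinfun_apply (sqrt_iter B n) (S x)"
proof -
  interpret S: bounded_linear S by (rule S)
  show ?thesis
    by (induction n arbitrary: x) (simp_all add: S.zero S.add S.scale comm blinfun.bilinear_simps)
qed

lemma sqrt_iter_scaleC:
  fixes B :: "'a::chilbert_space \<Rightarrow>\<^sub>L 'a"
  assumes "\<And>x. blinfun_apply B (c *\<^sub>C x) = c *\<^sub>C blinfun_apply B x"
  shows "blinfun_apply (sqrt_iter B n) (c *\<^sub>C x) = c *\<^sub>C blinfun_apply (sqrt_iter B n) x"
  by (induction n arbitrary: x)
    (simp_all add: assms blinfun.bilinear_simps scaleC_add_right scaleR_scaleC scaleC_scaleC
      mult.commute)

lemma sqrt_iter_symmetric:
  fixes B :: "'a::real_inner \<Rightarrow>\<^sub>L 'a"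
  assumes "\<And>x y. inner (blinfun_apply B x) y = inner x (blinfun_apply B y)"
  shows "inner (blinfun_apply (sqrt_iter B n) x) y = inner x (blinfun_apply (sqrt_iter B n) y)"
  by (induction n arbitrary: x y)
    (simp_all add: assms blinfun.bilinear_simps inner_add_left inner_add_right)

section \<open>Continuity of complex scalar multiplication\<close>

lemma norm_scaleC: "norm (c *\<^sub>C x) = cmod c * norm (x::'a::complex_inner)"
proof -
  have "(norm (c *\<^sub>C x))\<^sup>2 = Re (c * cnj c * cinner x x)"
    by (simp add: power2_norm_eq_inner inner_eq_Re_cinner cinner_scaleC_left cinner_scaleC_right
        algebra_simps)
  also have "\<dots> = (cmod c * norm x)\<^sup>2"
    by (simp add: complex_norm_square[symmetric] power_mult_distrib power2_norm_eq_inner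
        inner_eq_Re_cinner flip: of_real_power)
  finally show ?thesis by (simp add: power2_eq_iff_nonneg)
qed

lemma bounded_linear_scaleC: "bounded_linear (\<lambda>x::'a::complex_inner. c *\<^sub>C x)"
  by (rule bounded_linear_intro[of _ "cmod c"])
    (simp_all add: scaleC_add_right scaleR_scaleC scaleC_scaleC norm_scaleC mult.commute)

lemma pos_semidef_sqrt_contraction:
  fixes W :: "'a::chilbert_space \<Rightarrow> 'a"
  assumes W: "pos_semidef W" and contr: "\<And>x. norm (W x) \<le> norm x"
  shows "\<exists>R. pos_semidef R \<and> (\<forall>x. R (R x) = W x) \<and>
    (\<forall>S. bounded_linear S \<longrightarrow> (\<forall>x. S (W x) = W (S x)) \<longrightarrow> (\<forall>x. S (R x) = R (S x)))"
proof -
  define B where "B = Blinfun (\<lambda>x. x - W x)"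
  have B: "blinfun_apply B x = x - W x" for x
    unfolding B_def
    by (simp add: bounded_linear_Blinfun_apply bounded_linear_sub bounded_linear_ident
        pos_semidef_bounded_linear[OF W])
  have WC: "W (c *\<^sub>C x) = c *\<^sub>C W x" for c x
    using W by (simp add: pos_semidef_def bounded_clinear_def)
  have nB: "norm B \<le> 1"
    by (rule norm_blinfun_bound) (simp_all add: B pos_semidef_diff_norm_le[OF W contr])
  then obtain X where X: "sqrt_iter B \<longlonglongrightarrow> X"
    using convergent_sqrt_iter by (auto simp: convergent_def)
  have Xx: "(\<lambda>n. blinfun_apply (sqrt_iter B n) x) \<longlonglongrightarrow> blinfun_apply X x" for x
    by (intro tendsto_intros X)
  have "norm (sqrt_iter B n) \<le> 1" for n
    using norm_sqrt_iter[OF nB, of n] sqrt_maj_bounds(2)[of n] by linarith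
  \<comment> \<open>This bound is what makes I - X positive below.\<close>
  then have nX: "norm X \<le> 1"
    using X by (intro LIMSEQ_le_const2[OF tendsto_norm]) auto
  have "(\<lambda>n. sqrt_iter B (Suc n)) \<longlonglongrightarrow> (1/2) *\<^sub>R (B + (X o\<^sub>L X))"
    unfolding sqrt_iter.simps
    by (intro tendsto_intros X bounded_bilinear.tendsto[OF bounded_bilinear_blinfun_compose])
  with LIMSEQ_Suc[OF X] have fixX: "X = (1/2) *\<^sub>R (B + (X o\<^sub>L X))"
    by (rule LIMSEQ_unique)
  \<comment> \<open>The fixed point equation solved for X^2, from which (I - X)^2 = W follows by
    expansion.\<close>
  have XX: "blinfun_apply X (blinfun_apply X x) = 2 *\<^sub>R blinfun_apply X x - (x - W x)" for x
  proof -
    have "blinfun_apply X x = (1/2) *\<^sub>R (x - W x + blinfun_apply X (blinfun_apply X x))"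
      by (subst fixX) (simp add: blinfun.bilinear_simps B)
    from arg_cong[OF this, of "\<lambda>v. 2 *\<^sub>R v"] show ?thesis by simp
  qed
  have XC: "blinfun_apply X (c *\<^sub>C x) = c *\<^sub>C blinfun_apply X x" for c x
  proof (rule LIMSEQ_unique[OF Xx])
    have "blinfun_apply (sqrt_iter B n) (c *\<^sub>C x) = c *\<^sub>C blinfun_apply (sqrt_iter B n) x" for n
      by (rule sqrt_iter_scaleC)
        (simp add: B WC bounded_linear.linear[OF bounded_linear_scaleC] linear_diff)
    then show "(\<lambda>n. blinfun_apply (sqrt_iter B n) (c *\<^sub>C x)) \<longlonglongrightarrow> c *\<^sub>C blinfun_apply X x"
      by (simp add: bounded_linear.tendsto[OF bounded_linear_scaleC Xx])
  qed
  have Xsym: "inner (blinfun_apply X x) y = inner x (blinfun_apply X y)" for x y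
  proof (rule LIMSEQ_unique)
    show "(\<lambda>n. inner (blinfun_apply (sqrt_iter B n) x) y) \<longlonglongrightarrow> inner (blinfun_apply X x) y"
      by (intro tendsto_intros Xx)
    have "inner (blinfun_apply (sqrt_iter B n) x) y = inner x (blinfun_apply (sqrt_iter B n) y)" for n
      by (rule sqrt_iter_symmetric)
        (simp add: B inner_diff_left inner_diff_right pos_semidef_symmetric[OF W])
    then show "(\<lambda>n. inner (blinfun_apply (sqrt_iter B n) x) y) \<longlonglongrightarrow> inner x (blinfun_apply X y)"
      by (simp add: tendsto_inner Xx)
  qed
  define R where "R x = x - blinfun_apply X x" for x
  show ?thesis
  proof (intro exI conjI allI impI)
    show "pos_semidef R"
    proof (rule pos_semidefI)
      have "bounded_linear R"
        unfolding R_def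
        by (intro bounded_linear_sub bounded_linear_ident blinfun.bounded_linear_right)
      then show "bounded_clinear R"
        by (simp add: bounded_clinear_def R_def XC
            bounded_linear.linear[OF bounded_linear_scaleC] linear_diff)
      show "inner (R x) y = inner x (R y)" for x y
        by (simp add: R_def inner_diff_left inner_diff_right Xsym)
      show "0 \<le> inner (R x) x" for x
      proof -
        have "inner (blinfun_apply X x) x \<le> norm (blinfun_apply X x) * norm x"
          by (rule norm_cauchy_schwarz)
        also have "\<dots> \<le> norm x * norm x"
          using norm_blinfun[of X x] mult_right_mono[OF nX norm_ge_zero[of x]]
          by (intro mult_right_mono) auto
        finally show ?thesis
          by (simp add: R_def inner_diff_left power2_norm_eq_inner[symmetric] power2_eq_square)
      qed
    qed
    show "R (R x) = W x" for x
      unfolding R_def blinfun.diff_right XX scaleR_2 by simp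
    show "S (R x) = R (S x)"
      if S: "bounded_linear S" and comm: "\<forall>x. S (W x) = W (S x)" for S x
    proof -
      interpret S: bounded_linear S by (rule S)
      have "S (blinfun_apply X x) = blinfun_apply X (S x)"
      proof (rule LIMSEQ_unique[OF S.tendsto[OF Xx]])
        show "(\<lambda>n. S (blinfun_apply (sqrt_iter B n) x)) \<longlonglongrightarrow> blinfun_apply X (S x)"
          by (subst sqrt_iter_commute[OF S]) (simp_all add: B S.diff comm Xx)
      qed
      then show ?thesis by (simp add: R_def S.diff)
    qed
  qed
qed

text \<open>Rescaling by a bound \<open>c\<close> of \<open>W\<close> reduces to a contraction; its
  root is multiplied by \<open>sqrt c\<close>, and commuting with \<open>W\<close> is the same as
  commuting with \<open>W / c\<close>.\<close>

lemma pos_semidef_sqrt_exists: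
  fixes W :: "'a::chilbert_space \<Rightarrow> 'a"
  assumes W: "pos_semidef W"
  shows "\<exists>R. pos_semidef R \<and> (\<forall>x. R (R x) = W x) \<and>
    (\<forall>S. bounded_linear S \<longrightarrow> (\<forall>x. S (W x) = W (S x)) \<longrightarrow> (\<forall>x. S (R x) = R (S x)))"
proof -
  interpret W: bounded_linear W by (rule pos_semidef_bounded_linear[OF W])
  \<comment> \<open>\<open>pos_bounded\<close> gives a strictly positive constant even when
    \<open>W\<close> is zero.\<close>
  obtain c where "0 < c" and c: "\<And>x. norm (W x) \<le> norm x * c"
    using W.pos_bounded by blast
  let ?V = "\<lambda>x. (1 / c) *\<^sub>R W x"
  have V: "pos_semidef ?V"
    using \<open>0 < c\<close> by (intro pos_semidef_scaleR W) simp
  have "norm (?V x) \<le> norm x" for x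
    using c[of x] \<open>0 < c\<close> by (simp add: field_simps)
  with V obtain R where R: "pos_semidef R" "\<And>x. R (R x) = ?V x"
    and comm: "\<forall>S. bounded_linear S \<longrightarrow> (\<forall>x. S (?V x) = ?V (S x)) \<longrightarrow> (\<forall>x. S (R x) = R (S x))"
    using pos_semidef_sqrt_contraction[of ?V] by blast
  interpret R: bounded_linear R by (rule pos_semidef_bounded_linear[OF R(1)])
  show ?thesis
  proof (intro exI conjI allI impI)
    show "pos_semidef (\<lambda>x. sqrt c *\<^sub>R R x)"
      using \<open>0 < c\<close> by (intro pos_semidef_scaleR R) simp
    show "sqrt c *\<^sub>R R (sqrt c *\<^sub>R R x) = W x" for x
      using \<open>0 < c\<close> by (simp add: R.scale R(2))
    show "S (sqrt c *\<^sub>R R x) = sqrt c *\<^sub>R R (S x)"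
      if S: "bounded_linear S" and SW: "\<forall>x. S (W x) = W (S x)" for S x
    proof -
      interpret S: bounded_linear S by (rule S)
      show ?thesis using comm S by (simp add: S.scale SW)
    qed
  qed
qed

text \<open>For commuting roots (R + S)(R - S) = R^2 - S^2 = 0. Positivity then makes both
  \<open>R\<close> and \<open>S\<close> vanish on the range of R - S, and symmetry makes that range
  trivial.\<close>

lemma pos_semidef_sqrt_unique:
  fixes R S :: "'a::chilbert_space \<Rightarrow> 'a"
  assumes R: "pos_semidef R" and S: "pos_semidef S"
    and eq: "\<And>x. R (R x) = S (S x)" and comm: "\<And>x. S (R x) = R (S x)"
  shows "R = S"
proof
  fix x
  interpret R: bounded_linear R by (rule pos_semidef_bounded_linear[OF R])
  interpret S: bounded_linear S by (rule pos_semidef_bounded_linear[OF S])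
  define y where "y = R x - S x"
  have "R y + S y = 0"
    by (simp add: y_def R.diff S.diff eq comm)
  then have "inner (R y) y + inner (S y) y = 0"
    by (metis inner_add_left inner_zero_left)
  then have "inner (R y) y = 0" "inner (S y) y = 0"
    using pos_semidef_nonneg[OF R, of y] pos_semidef_nonneg[OF S, of y] by linarith+
  then have "R y = 0" "S y = 0"
    using pos_semidef_eq_zero R S by blast+
  \<comment> \<open>One factor \<open>y\<close> is expanded and R - S is moved across the inner
    product.\<close>
  moreover have "inner y y = inner x (R y) - inner x (S y)"
    by (simp add: y_def inner_diff_left[of "R x"] pos_semidef_symmetric[OF R, of x]
        pos_semidef_symmetric[OF S, of x] del: inner_diff_right)
  ultimately have "y = 0" by simp
  then show "R x = S x" by (simp add: y_def)
qed

text \<open>Justifies the definite description in \<open>op_sqrt\<close>.\<close>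

lemma op_sqrt_spec:
  assumes W: "pos_semidef W"
  shows "pos_semidef (op_sqrt W) \<and> op_sqrt W \<circ> op_sqrt W = W"
proof -
  obtain R where R: "pos_semidef R" "\<And>x. R (R x) = W x"
    and comm: "\<forall>S. bounded_linear S \<longrightarrow> (\<forall>x. S (W x) = W (S x)) \<longrightarrow> (\<forall>x. S (R x) = R (S x))"
    using pos_semidef_sqrt_exists[OF W] by blast
  have "\<exists>!R. pos_semidef R \<and> R \<circ> R = W"
  proof (rule ex1I[of _ R])
    fix S assume S: "pos_semidef S \<and> S \<circ> S = W"
    then have SS: "S (S x) = W x" for x by (auto simp: fun_eq_iff)
    have "bounded_linear S"
      using S by (blast intro: pos_semidef_bounded_linear)
    \<comment> \<open>Any competing root commutes with its own square \<open>W\<close>, hence with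
      the constructed root \<open>R\<close>.\<close>
    moreover have "\<forall>x. S (W x) = W (S x)"
      by (simp flip: SS)
    ultimately have "S (R x) = R (S x)" for x
      using comm by blast
    then show "S = R"
      using R S SS by (intro pos_semidef_sqrt_unique) simp_all
  qed (use R in auto)
  then show ?thesis unfolding op_sqrt_def by (rule theI')
qed

lemma seminorm_W_power2:
  assumes "pos_semidef W"
  shows "(seminorm_W W x)\<^sup>2 = inner (W x) x"
proof -
  note R = op_sqrt_spec[OF assms]
  have "(seminorm_W W x)\<^sup>2 = inner (op_sqrt W (op_sqrt W x)) x"
    using R by (simp add: seminorm_W_def power2_norm_eq_inner pos_semidef_symmetric inner_commute)
  with R show ?thesis by (metis comp_apply)
qed

lemma seminorm_W_le_iff:
  assumes "pos_semidef W"
  shows "seminorm_W W x \<le> seminorm_W W y \<longleftrightarrow> inner (W x) x \<le> inner (W y) y"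
  by (simp add: seminorm_W_power2[OF assms, symmetric] seminorm_W_def)

section \<open>Weighted least squares\<close>

text \<open>A complex subspace contains \<open>i s\<close> along with \<open>s\<close>, and testing
  the real condition there yields the imaginary part.\<close>

lemma W_orth_iff_inner:
  assumes S: "complex_vector.subspace S"
  shows "x \<in> W_orth W S \<longleftrightarrow> (\<forall>s\<in>S. inner (W x) s = 0)"
proof
  assume "x \<in> W_orth W S"
  then show "\<forall>s\<in>S. inner (W x) s = 0" by (simp add: W_orth_def inner_eq_Re_cinner)
next
  assume *: "\<forall>s\<in>S. inner (W x) s = 0"
  then have "inner (W x) (\<i> *\<^sub>C s) = 0" if "s \<in> S" for s
    using complex_vector.subspace_scale[OF S that] by blast
  with * show "x \<in> W_orth W S"
    by (simp add: W_orth_def complex_eq_iff Im_cinner inner_eq_Re_cinner[symmetric])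
qed

text \<open>First variation of the quadratic form of \<open>W\<close>: a minimiser is perturbed
  along real multiples of \<open>s\<close>; conversely, orthogonality kills the cross term and
  leaves a nonnegative remainder.\<close>

lemma seminorm_W_arg_min_iff:
  assumes W: "pos_semidef W" and S: "complex_vector.subspace S" and z: "z \<in> S"
  shows "is_arg_min (\<lambda>y. seminorm_W W (y - b)) (\<lambda>y. y \<in> S) z \<longleftrightarrow> b - z \<in> W_orth W S"
proof -
  interpret W: bounded_linear W by (rule pos_semidef_bounded_linear[OF W])
  let ?q = "\<lambda>x. inner (W x) x"
  have "is_arg_min (\<lambda>y. seminorm_W W (y - b)) (\<lambda>y. y \<in> S) z
      \<longleftrightarrow> (\<forall>y\<in>S. ?q (z - b) \<le> ?q (y - b))"
    using z by (auto simp: is_arg_min_linorder seminorm_W_le_iff[OF W])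
  also have "\<dots> \<longleftrightarrow> (\<forall>s\<in>S. inner (W (z - b)) s = 0)"
  proof (intro iffI ballI)
    fix s assume min: "\<forall>y\<in>S. ?q (z - b) \<le> ?q (y - b)" and s: "s \<in> S"
    \<comment> \<open>The explicit 0 is the constant coefficient, so the discriminant bound forces
      the linear one to vanish.\<close>
    have "0 \<le> 0 + 2 * t * inner (W (z - b)) s + t\<^sup>2 * ?q s" for t
    proof -
      have "z + t *\<^sub>R s \<in> S"
        using z s by (simp add: scaleR_scaleC S complex_vector.subspace_add complex_vector.subspace_scale)
      then have "?q (z - b) \<le> ?q (z - b + t *\<^sub>R s)"
        using min by (metis add_diff_eq add.commute diff_add_eq)
      then show ?thesis by (simp add: pos_semidef_inner_add_scaleR[OF W])
    qed
    then have "(inner (W (z - b)) s)\<^sup>2 \<le> 0 * ?q s"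
      by (rule quadratic_nonneg_imp_discriminant) (rule pos_semidef_nonneg[OF W])
    then show "inner (W (z - b)) s = 0" by simp
  next
    fix y assume orth: "\<forall>s\<in>S. inner (W (z - b)) s = 0" and y: "y \<in> S"
    then have "inner (W (z - b)) (y - z) = 0"
      using z by (simp add: S complex_vector.subspace_diff)
    with pos_semidef_inner_add_scaleR[OF W, of "z - b" 1 "y - z"]
    show "?q (z - b) \<le> ?q (y - b)" by (simp add: pos_semidef_nonneg[OF W])
  qed
  also have "\<dots> \<longleftrightarrow> b - z \<in> W_orth W S"
    unfolding W_orth_iff_inner[OF S] W.diff inner_diff_left by auto
  finally show ?thesis .
qed

lemma subspace_Range:
  assumes "linear_relation A"
  shows "complex_vector.subspace (Range A)"
proof (rule complex_vector.subspaceI)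
  have A: "complex_vector.subspace A" using assms by (simp add: linear_relation_def)
  show "0 \<in> Range A"
    using complex_vector.subspace_0[OF A] by (metis Range.intros zero_prod_def)
  show "x + y \<in> Range A" if xy: "x \<in> Range A" "y \<in> Range A" for x y
  proof -
    obtain u v where "(u, x) \<in> A" "(v, y) \<in> A" using xy by blast
    from complex_vector.subspace_add[OF A this] show ?thesis by auto
  qed
  show "c *\<^sub>C x \<in> Range A" if x: "x \<in> Range A" for c x
  proof -
    obtain u where "(u, x) \<in> A" using x by blast
    from complex_vector.subspace_scale[OF A this] show ?thesis by (auto simp: scaleC_prod_def)
  qed
qed

lemma wls_solution_exists_iff:
  assumes W: "pos_semidef W" and A: "linear_relation A"
  shows "(\<exists>x\<^sub>0. wls_solution W A b x\<^sub>0) \<longleftrightarrow> b \<in> Domain (W_proj W (Range A))"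
proof -
  \<comment> \<open>A minimiser in the range always has a preimage under \<open>A\<close>, so only
    the minimiser matters.\<close>
  have "(\<exists>x\<^sub>0. wls_solution W A b x\<^sub>0) \<longleftrightarrow>
      (\<exists>z\<in>Range A. is_arg_min (\<lambda>y. seminorm_W W (y - b)) (\<lambda>y. y \<in> Range A) z)"
    unfolding wls_solution_def by blast
  also have "\<dots> \<longleftrightarrow> (\<exists>z\<in>Range A. b - z \<in> W_orth W (Range A))"
    using seminorm_W_arg_min_iff[OF W subspace_Range[OF A]] by blast
  also have "\<dots> \<longleftrightarrow> b \<in> Domain (W_proj W (Range A))"
  proof
    assume "\<exists>z\<in>Range A. b - z \<in> W_orth W (Range A)"
    then obtain z where "z \<in> Range A" "b - z \<in> W_orth W (Range A)" by blast
    then have "(z + (b - z), z) \<in> W_proj W (Range A)" unfolding W_proj_def by blast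
    then show "b \<in> Domain (W_proj W (Range A))" by auto
  next
    assume "b \<in> Domain (W_proj W (Range A))"
    then obtain s n where "b = s + n" "s \<in> Range A" "n \<in> W_orth W (Range A)"
      unfolding W_proj_def by blast
    then show "\<exists>z\<in>Range A. b - z \<in> W_orth W (Range A)"
      by (intro bexI[of _ s]) simp_all
  qed
  finally show ?thesis .
qed

theorem proposition5p1:
  fixes W :: "'a::chilbert_space \<Rightarrow> 'a"
    and A :: "('a \<times> 'a) set"
    and b :: 'a
  assumes separable: "\<exists>D::'a set. countable D \<and> closure D = UNIV"
    and W: "pos_semidef W"
    and A: "linear_relation A"
  shows "((\<exists>x\<^sub>0. wls_solution W A b x\<^sub>0) \<longleftrightarrow> b \<in> Domain (W_proj W (Range A))) \<and>
    ((\<forall>b'. \<exists>x\<^sub>0. wls_solution W A b' x\<^sub>0) \<longleftrightarrow> W_complementable W (Range A))"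
  \<comment> \<open>The pointwise equivalence, quantified over all right-hand sides, says that the
    domain is the whole space.\<close>
  unfolding W_complementable_def wls_solution_exists_iff[OF W A] by auto

end
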